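(* Let $A\in\mathbb{C}^{q\times n}$, let $W\in\mathbb{C}^{n\times q}$ with $W\neq 0$, and let $m$ be a positive integer. Then the $W$-weighted $m$-weak group inverse $A^{\mathrm{wg}_m,W}$ of $A$ satisfies: (1) $A^{\mathrm{wg}_m,W}=(AW)^{\mathrm{wg}_m}A(WA)^{\mathrm{wg}_m}$; (2) $A^{\mathrm{wg}_m,W}=(AW)^{\mathrm{cEP}}A(WA)^{\mathrm{wg}_m}$; (3) $A^{\mathrm{wg}_m,W}=(AW)^{D}A(WA)^{\mathrm{wg}_m}$.
   Context: Notation: $\mathcal{R}(B)$ is the range (column space) of $B$. For square $B$, $B^0=I$ and $\mathrm{Ind}(B)$ is the smallest integer $j\ge 0$ with $\mathrm{rank}(B^{j})=\mathrm{rank}(B^{j+1})$. $P_{\mathcal{T}}$ is the orthogonal projector onto the subspace $\mathcal{T}$. For a square matrix $B$ with $j=\mathrm{Ind}(B)$: the Drazin inverse $B^D$ is the unique $X$ with $B^{j}=B^{j+1}X$, $X=XBX$, $BX=XB$; the core-EP inverse $B^{\mathrm{cEP}}$ is the unique $X$ with $BX=P_{\mathcal{R}(B^{j})}$ and $\mathcal{R}(X)\subseteq\mathcal{R}(B^{j})$; the $m$-weak group inverse is $B^{\mathrm{wg}_m}=(B^{\mathrm{cEP}})^{m+1}B^m$. $W$-product: for $X,Y\in\mathbb{C}^{q\times n}$, $X\star Y=XWY$, and $X^{\star l}=X\star\cdots\star X$ ($l$ factors) for $l\ge 1$. Weighted core-EP inverse: with $k=\max\{\mathrm{Ind}(AW),\mathrm{Ind}(WA)\}$,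 $A^{\mathrm{cEP},W}\in\mathbb{C}^{q\times n}$ is the unique matrix $X$ with $WAWX=P_{\mathcal{R}((WA)^k)}$ and $\mathcal{R}(X)\subseteq\mathcal{R}((AW)^k)$ (existence and uniqueness are known). $W$-weighted $m$-weak group inverse: $A^{\mathrm{wg}_m,W}=(A^{\mathrm{cEP},W})^{\star(m+1)}\,W\,A^{\star m}$. *)

theory Defs
  imports "HOL-Analysis.Analysis"
begin

text \<open>
  A matrix in \<open>\<complex>\<^sup>q\<^sup>\<times>\<^sup>n\<close> has type \<open>complex^'n^'q\<close> (rows are indexed by \<open>'q\<close>, columns by \<open>'n\<close>).
  The power \<open>^\<close> and the product \<open>*\<close> on \<open>complex^'n^'n\<close> act entrywise, so the power with
  respect to the matrix product \<open>**\<close> is defined separately.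
\<close>

primrec mat_pow :: "complex^'n^'n \<Rightarrow> nat \<Rightarrow> complex^'n^'n" where
  "mat_pow B 0 = mat 1"
| "mat_pow B (Suc k) = B ** mat_pow B k"

definition mat_range :: "complex^'n^'m \<Rightarrow> (complex^'m) set" where
  "mat_range B = range (\<lambda>x. B *v x)"

definition mat_index :: "complex^'n^'n \<Rightarrow> nat" where
  "mat_index B = (LEAST j. rank (mat_pow B j) = rank (mat_pow B (Suc j)))"

text \<open>
  The library's \<open>\<bullet>\<close> on \<open>complex^'n\<close> is the real inner product, that is, the real part of this one.
\<close>

definition hermitian_inner :: "complex^'n \<Rightarrow> complex^'n \<Rightarrow> complex" where
  "hermitian_inner x y = (\<Sum>i\<in>UNIV. x $ i * cnj (y $ i))"

definition orth_projector :: "(complex^'n) set \<Rightarrow> complex^'n^'n" where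
  "orth_projector T =
    (THE P. \<forall>x. P *v x \<in> T \<and> (\<forall>t\<in>T. hermitian_inner (x - P *v x) t = 0))"

definition drazin_inv :: "complex^'n^'n \<Rightarrow> complex^'n^'n" where
  "drazin_inv B =
    (THE X. mat_pow B (mat_index B) = mat_pow B (Suc (mat_index B)) ** X \<and>
            X = X ** B ** X \<and> B ** X = X ** B)"

definition core_EP_inv :: "complex^'n^'n \<Rightarrow> complex^'n^'n" where
  "core_EP_inv B =
    (THE X. B ** X = orth_projector (mat_range (mat_pow B (mat_index B))) \<and>
            mat_range X \<subseteq> mat_range (mat_pow B (mat_index B)))"

definition weak_group_inv :: "nat \<Rightarrow> complex^'n^'n \<Rightarrow> complex^'n^'n" where
  "weak_group_inv m B = mat_pow (core_EP_inv B) (m + 1) ** mat_pow B m"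

definition W_prod :: "complex^'q^'n \<Rightarrow> complex^'n^'q \<Rightarrow> complex^'n^'q \<Rightarrow> complex^'n^'q" where
  "W_prod W X Y = X ** W ** Y"

text \<open>
  \<open>W_pow W X l\<close> is the product of \<open>l\<close> factors \<open>X\<close> for \<open>l \<ge> 1\<close>. The \<open>W\<close>-product need not have a
  unit, so the value at \<open>l = 0\<close> (here \<open>X\<close>, by truncated subtraction) has no meaning.
\<close>

definition W_pow :: "complex^'q^'n \<Rightarrow> complex^'n^'q \<Rightarrow> nat \<Rightarrow> complex^'n^'q" where
  "W_pow W X l = (W_prod W X ^^ (l - 1)) X"

definition weighted_core_EP_inv :: "complex^'q^'n \<Rightarrow> complex^'n^'q \<Rightarrow> complex^'n^'q" where
  "weighted_core_EP_inv W A =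
    (let k = max (mat_index (A ** W)) (mat_index (W ** A)) in
      THE X. W ** A ** W ** X = orth_projector (mat_range (mat_pow (W ** A) k)) \<and>
             mat_range X \<subseteq> mat_range (mat_pow (A ** W) k))"

definition weighted_weak_group_inv ::
    "nat \<Rightarrow> complex^'q^'n \<Rightarrow> complex^'n^'q \<Rightarrow> complex^'n^'q" where
  "weighted_weak_group_inv m W A =
    W_pow W (weighted_core_EP_inv W A) (m + 1) ** W ** W_pow W A m"

end

theory Submission
  imports Defs
begin

text \<open>
  Everything reduces to the Drazin inverse. Write \<open>E = B ** drazin_inv B\<close>. This idempotent has range
  \<open>mat_range (mat_pow B k)\<close> for every \<open>k \<ge> mat_index B\<close>, so a range inclusion
  \<open>mat_range M \<subseteq> mat_range (mat_pow B k)\<close> is the equation \<open>E ** M = M\<close>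
  (\<open>mat_range_subset_pow_iff\<close>), and the uniquely characterised inverses become computable: with \<open>P\<close>
  the orthogonal projector onto the range of \<open>E\<close>, the core-EP inverse of \<open>B\<close> is
  \<open>drazin_inv B ** P\<close>.

  Put \<open>Q = W ** A\<close> and let \<open>C\<close> be the core-EP inverse of \<open>Q\<close>. Since \<open>Q ** C ** C = C\<close>, the
  weighted core-EP inverse of \<open>A\<close> is \<open>A ** C ** C\<close>, and the factors \<open>W ** A\<close> arising in its
  \<open>W\<close>-powers cancel against powers of \<open>C\<close>. So the weighted \<open>m\<close>-weak group inverse is
  \<open>V = A ** C ** G\<close>, where \<open>G\<close> is the \<open>m\<close>-weak group inverse of \<open>Q\<close>. From \<open>Q ** C ** G = G\<close> one
  gets \<open>A ** G = (A ** W) ** V\<close>. Finally, the range of \<open>V\<close> lies in the range of a high power of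
  \<open>A ** W\<close>, where \<open>A ** W\<close> acts invertibly, and there the weak group inverse, the core-EP inverse
  and the Drazin inverse of \<open>A ** W\<close> all undo the multiplication by \<open>A ** W\<close>. Applying any one of
  them to \<open>A ** G\<close> therefore returns \<open>V\<close>.
\<close>

section \<open>Powers and ranges of matrices\<close>

lemma mat_pow_add: "mat_pow B (i + j) = mat_pow B i ** mat_pow B j"
  by (induction i) (simp_all add: matrix_mul_assoc)

lemma mat_pow_Suc_right: "mat_pow B (Suc k) = mat_pow B k ** B"
  using mat_pow_add[of B k 1] by simp

lemma mat_pow_intertwine: "A ** mat_pow (W ** A) k = mat_pow (A ** W) k ** A"
proof (induction k)
  case (Suc k)
  have "A ** mat_pow (W ** A) (Suc k) = A ** W ** (A ** mat_pow (W ** A) k)"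
    by (simp add: matrix_mul_assoc)
  then show ?case
    by (simp add: Suc.IH matrix_mul_assoc)
qed simp

lemma mat_pow_transpose: "mat_pow (transpose B) k = transpose (mat_pow B k)"
proof (induction k)
  case (Suc k)
  then show ?case
    by (metis mat_pow.simps(2) mat_pow_Suc_right matrix_transpose_mul)
qed simp

lemma mat_range_mult_subset: "mat_range (M ** N) \<subseteq> mat_range M"
  unfolding mat_range_def by (auto simp: matrix_vector_mul_assoc[symmetric])

lemma mat_range_mult: "mat_range (M ** N) = (*v) M ` mat_range N"
  unfolding mat_range_def by (auto simp: matrix_vector_mul_assoc[symmetric] image_image)

lemma subspace_mat_range: "vec.subspace (mat_range M)"
  unfolding mat_range_def
  by (rule vec.linear_subspace_image[OF matrix_vector_mul_linear_gen vec.subspace_UNIV])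

lemma mat_range_subset_iff_factor: "mat_range M \<subseteq> mat_range N \<longleftrightarrow> (\<exists>Z. M = N ** Z)"
proof
  assume sub: "mat_range M \<subseteq> mat_range N"
  have "\<forall>j. \<exists>z. M *v axis j 1 = N *v z"
    using sub unfolding mat_range_def by blast
  then obtain z where z: "\<And>j. M *v axis j 1 = N *v z j"
    by metis
  define Z where "Z = (\<chi> i j. z j $ i)"
  have "M $ i $ j = (N ** Z) $ i $ j" for i j
  proof -
    have "M $ i $ j = (M *v axis j 1) $ i"
      by (simp add: matrix_vector_mult_def axis_def if_distrib cong: if_cong)
    also have "\<dots> = (N *v z j) $ i"
      by (simp only: z)
    also have "\<dots> = (N ** Z) $ i $ j"
      by (simp add: matrix_vector_mult_def matrix_matrix_mult_def Z_def)
    finally show ?thesis .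
  qed
  then show "\<exists>Z. M = N ** Z"
    by (auto simp: vec_eq_iff)
next
  assume "\<exists>Z. M = N ** Z"
  then show "mat_range M \<subseteq> mat_range N"
    using mat_range_mult_subset by auto
qed

lemma mat_range_eq_span_columns: "mat_range M = vec.span (columns M)"
proof
  show "mat_range M \<subseteq> vec.span (columns M)"
    unfolding mat_range_def using matrix_vector_mult_in_columnspace_gen by blast
  have "column j M = M *v axis j 1" for j
    by (simp add: vec_eq_iff column_def matrix_vector_mult_def axis_def if_distrib cong: if_cong)
  then have "columns M \<subseteq> mat_range M"
    unfolding mat_range_def columns_def by auto
  then show "vec.span (columns M) \<subseteq> mat_range M"
    using subspace_mat_range vec.span_minimal by blast
qed

text \<open>The library defines the rank of a matrix over a field as its row rank.\<close>

lemma rank_eq_dim_range_transpose: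
  fixes M :: "complex^'n^'m"
  shows "rank M = vec.dim (mat_range (transpose M))"
  by (simp add: row_rank_def_gen mat_range_eq_span_columns)

section \<open>The Drazin inverse\<close>

text \<open>
  The ranks of the powers cannot decrease forever, so the least number in the definition of
  \<open>mat_index\<close> exists.
\<close>

lemma rank_mat_pow_index:
  "rank (mat_pow B (mat_index B)) = rank (mat_pow B (Suc (mat_index B)))"
proof -
  define r where "r = (\<lambda>j. rank (mat_pow B j))"
  have le: "r (Suc j) \<le> r j" for j
    unfolding r_def rank_eq_dim_range_transpose
    by (simp add: matrix_transpose_mul mat_range_mult_subset vec.dim_subset)
  have "\<exists>j. r j = r (Suc j)"
  proof (rule ccontr)
    assume "\<nexists>j. r j = r (Suc j)"
    then have less: "r (Suc j) < r j" for j
      using le[of j] by (metis le_neq_implies_less)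
    have "r j + j \<le> r 0" for j
    proof (induction j)
      case (Suc j)
      then show ?case using less[of j] by linarith
    qed simp
    from this[of "Suc (r 0)"] show False by simp
  qed
  then show ?thesis
    unfolding r_def mat_index_def by (rule LeastI_ex)
qed

text \<open>Equal row ranks of nested row spaces make the row spaces equal, hence a factor on the left.\<close>

lemma mat_pow_index_left_factor:
  "\<exists>Y. mat_pow B (mat_index B) = Y ** mat_pow B (Suc (mat_index B))"
proof -
  let ?j = "mat_index B"
  let ?R = "\<lambda>i. mat_range (transpose (mat_pow B i))"
  have "?R (Suc ?j) \<subseteq> ?R ?j"
    by (simp add: matrix_transpose_mul mat_range_mult_subset)
  moreover have "vec.dim (?R (Suc ?j)) = vec.dim (?R ?j)"
    using rank_mat_pow_index[of B] by (simp only: rank_eq_dim_range_transpose)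
  ultimately have "?R ?j = ?R (Suc ?j)"
    by (metis subspace_mat_range vec.subspace_dim_equal order_refl)
  then obtain Z where "transpose (mat_pow B ?j) = transpose (mat_pow B (Suc ?j)) ** Z"
    by (metis mat_range_subset_iff_factor order_refl)
  then have "mat_pow B ?j = transpose Z ** mat_pow B (Suc ?j)"
    by (metis matrix_transpose_mul transpose_transpose)
  then show ?thesis ..
qed

text \<open>
  The left factorisation makes \<open>B\<close> injective on the range of \<open>mat_pow B (mat_index B)\<close>, which \<open>B\<close>
  maps into itself; by finite dimension \<open>B\<close> maps that range onto itself.
\<close>

lemma mat_pow_index_right_factor:
  "\<exists>Z. mat_pow B (mat_index B) = mat_pow B (Suc (mat_index B)) ** Z"
proof -
  let ?j = "mat_index B"
  let ?S = "mat_range (mat_pow B ?j)"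
  obtain Y where Y: "mat_pow B ?j = Y ** mat_pow B (Suc ?j)"
    using mat_pow_index_left_factor by blast
  have inj: "inj_on ((*v) B) ?S"
  proof (rule inj_onI)
    fix x y assume "x \<in> ?S" "y \<in> ?S" and eq: "B *v x = B *v y"
    then obtain u v where uv: "x = mat_pow B ?j *v u" "y = mat_pow B ?j *v v"
      unfolding mat_range_def by blast
    have undo: "Y *v (B *v (mat_pow B ?j *v w)) = mat_pow B ?j *v w" for w
      using Y by (simp add: matrix_vector_mul_assoc matrix_mul_assoc)
    show "x = y" using eq undo uv by metis
  qed
  have image: "(*v) B ` ?S = mat_range (mat_pow B (Suc ?j))"
    by (simp add: mat_range_mult)
  have "vec.dim (mat_range (mat_pow B (Suc ?j))) = vec.dim ?S"
    using vec.dim_image_eq[OF matrix_vector_mul_linear_gen, of B ?S] inj image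
    by (simp add: vec.span_eq_iff[THEN iffD2, OF subspace_mat_range])
  moreover have "mat_range (mat_pow B (Suc ?j)) \<subseteq> ?S"
    by (simp only: mat_pow_Suc_right mat_range_mult_subset)
  ultimately have "?S = mat_range (mat_pow B (Suc ?j))"
    by (metis subspace_mat_range vec.subspace_dim_equal order_refl)
  then show ?thesis
    by (metis mat_range_subset_iff_factor order_refl)
qed

lemma right_factor_iterate:
  assumes "mat_pow B j = mat_pow B (Suc j) ** Z"
  shows "mat_pow B j = mat_pow B (j + i) ** mat_pow Z i"
proof (induction i)
  case (Suc i)
  have "mat_pow B (j + i) = mat_pow B i ** mat_pow B j"
    by (metis mat_pow_add add.commute)
  also have "\<dots> = mat_pow B i ** mat_pow B (Suc j) ** Z"
    using assms by (metis matrix_mul_assoc)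
  also have "mat_pow B i ** mat_pow B (Suc j) = mat_pow B (j + Suc i)"
    by (metis mat_pow_add add.commute add_Suc_shift)
  finally show ?case
    using Suc.IH by (simp add: matrix_mul_assoc)
qed simp

lemma left_factor_iterate:
  assumes "mat_pow B j = Y ** mat_pow B (Suc j)"
  shows "mat_pow B j = mat_pow Y i ** mat_pow B (j + i)"
proof -
  have "mat_pow (transpose B) j = mat_pow (transpose B) (Suc j) ** transpose Y"
    unfolding mat_pow_transpose by (metis assms matrix_transpose_mul)
  then have "mat_pow (transpose B) j = mat_pow (transpose B) (j + i) ** mat_pow (transpose Y) i"
    by (rule right_factor_iterate)
  then show ?thesis
    unfolding mat_pow_transpose by (metis matrix_transpose_mul transpose_transpose)
qed

text \<open>
  If \<open>B\<^sup>j = Y B\<^sup>j\<^sup>+\<^sup>1 = B\<^sup>j\<^sup>+\<^sup>1 Z\<close>, then \<open>Y\<^sup>j\<^sup>+\<^sup>1 B\<^sup>j = B\<^sup>j Z\<^sup>j\<^sup>+\<^sup>1\<close>, because both sides equal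
  \<open>Y\<^sup>j\<^sup>+\<^sup>1 B\<^sup>2\<^sup>j\<^sup>+\<^sup>1 Z\<^sup>j\<^sup>+\<^sup>1\<close>. This two-sided description makes it commute with \<open>B\<close>.
\<close>

lemma drazin_inv_exists:
  "\<exists>X. mat_pow B (mat_index B) = mat_pow B (Suc (mat_index B)) ** X \<and>
       X = X ** B ** X \<and> B ** X = X ** B"
proof -
  define j where "j = mat_index B"
  obtain Y where Y: "mat_pow B j = Y ** mat_pow B (Suc j)"
    unfolding j_def using mat_pow_index_left_factor by blast
  obtain Z where Z: "mat_pow B j = mat_pow B (Suc j) ** Z"
    unfolding j_def using mat_pow_index_right_factor by blast
  note Yi = left_factor_iterate[OF Y] and Zi = right_factor_iterate[OF Z]
  have shift: "mat_pow Y i ** mat_pow B j = mat_pow B j ** mat_pow Z i" for i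
  proof -
    have "mat_pow Y i ** mat_pow B j = mat_pow Y i ** mat_pow B (j + i) ** mat_pow Z i"
      using Zi[of i] by (metis matrix_mul_assoc)
    then show ?thesis
      by (simp only: Yi[of i, symmetric])
  qed
  define X where "X = mat_pow B j ** mat_pow Z (Suc j)"
  have BX: "B ** X = mat_pow B j ** mat_pow Z j"
  proof -
    have "B ** X = mat_pow B (Suc j) ** Z ** mat_pow Z j"
      by (simp add: X_def matrix_mul_assoc)
    then show ?thesis by (simp only: Z[symmetric])
  qed
  have XB: "X ** B = mat_pow Y j ** mat_pow B j"
  proof -
    have "X ** B = mat_pow Y (Suc j) ** mat_pow B j ** B"
      by (simp only: X_def shift)
    also have "\<dots> = mat_pow Y j ** (Y ** mat_pow B (Suc j))"
      by (simp only: mat_pow_Suc_right matrix_mul_assoc)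
    finally show ?thesis by (simp only: Y[symmetric])
  qed
  have "X ** B ** X = mat_pow Y j ** mat_pow B (j + j) ** mat_pow Z (Suc j)"
    unfolding XB mat_pow_add by (simp only: X_def matrix_mul_assoc)
  then have XBX: "X = X ** B ** X"
    by (simp only: Yi[of j, symmetric] X_def)
  have "mat_pow B (Suc j) ** X = mat_pow B j ** (B ** X)"
    by (simp only: mat_pow_Suc_right matrix_mul_assoc)
  also have "\<dots> = mat_pow B (j + j) ** mat_pow Z j"
    by (simp only: BX mat_pow_add matrix_mul_assoc)
  finally have "mat_pow B j = mat_pow B (Suc j) ** X"
    by (simp only: Zi[of j, symmetric])
  then show ?thesis
    using XBX BX XB shift unfolding j_def by metis
qed

lemma mat_pow_mult_outer_inverse:
  assumes "X = X ** B ** X" "B ** X = X ** B"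
  shows "mat_pow B (Suc k) ** mat_pow X (Suc k) = B ** X"
proof (induction k)
  case (Suc k)
  have "B ** mat_pow X (Suc (Suc k)) = (X ** B ** X) ** mat_pow X k"
    using assms(2) by (simp add: matrix_mul_assoc)
  then have "B ** mat_pow X (Suc (Suc k)) = mat_pow X (Suc k)"
    using assms(1) by simp
  moreover have "mat_pow B (Suc (Suc k)) = mat_pow B (Suc k) ** B"
    by (rule mat_pow_Suc_right)
  ultimately have "mat_pow B (Suc (Suc k)) ** mat_pow X (Suc (Suc k))
      = mat_pow B (Suc k) ** mat_pow X (Suc k)"
    by (metis matrix_mul_assoc)
  then show ?case using Suc.IH by simp
qed simp

lemma mat_pow_commute:
  assumes "B ** X = X ** B"
  shows "mat_pow B k ** X = X ** mat_pow B k"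
proof (induction k)
  case (Suc k)
  then show ?case using assms
    by (metis mat_pow.simps(2) matrix_mul_assoc)
qed simp

text \<open>
  Two Drazin inverses \<open>X\<close> and \<open>X'\<close> yield the same idempotent \<open>B ** X = B ** X'\<close>: both idempotents
  have \<open>B\<^sup>j\<^sup>+\<^sup>1\<close> as a left and as a right factor and leave that power unchanged from either side,
  so both equal \<open>B ** X' ** (B ** X)\<close>.
\<close>

lemma drazin_inv_unique:
  assumes X: "mat_pow B j = mat_pow B (Suc j) ** X" "X = X ** B ** X" "B ** X = X ** B"
    and X': "mat_pow B j = mat_pow B (Suc j) ** X'" "X' = X' ** B ** X'" "B ** X' = X' ** B"
  shows "X = X'"
proof -
  let ?P = "mat_pow B (Suc j)"
  have fix_right: "?P ** (B ** T) = ?P"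
    if "mat_pow B j = ?P ** T" "B ** T = T ** B" for T
    using that by (metis mat_pow_Suc_right matrix_mul_assoc)
  have fix_left: "B ** T ** ?P = ?P"
    if "mat_pow B j = ?P ** T" "B ** T = T ** B" for T
  proof -
    have "B ** (B ** T) = (B ** T) ** B"
      using that(2) by (metis matrix_mul_assoc)
    then have "?P ** (B ** T) = (B ** T) ** ?P"
      by (rule mat_pow_commute)
    then show ?thesis using fix_right[OF that] by simp
  qed
  have "B ** X = ?P ** mat_pow X (Suc j)"
    by (rule mat_pow_mult_outer_inverse[OF X(2,3), symmetric])
  then have E: "B ** X = B ** X' ** (B ** X)"
    using fix_left[OF X'(1,3)] by (metis matrix_mul_assoc)
  have "B ** X' = mat_pow X' (Suc j) ** ?P"
    using mat_pow_mult_outer_inverse[OF X'(2,3), of j] mat_pow_commute[of X' ?P "Suc j"]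
      mat_pow_commute[OF X'(3), of "Suc j"] by simp
  then have E': "B ** X' = B ** X' ** (B ** X)"
    using fix_right[OF X(1,3)] by (metis matrix_mul_assoc)
  have eq: "B ** X = B ** X'"
    using E E' by simp
  have "X = X ** (B ** X')"
    using X(2) eq by (metis matrix_mul_assoc)
  also have "\<dots> = X' ** B ** X'"
    using X(3) X'(3) eq by (metis matrix_mul_assoc)
  finally show ?thesis using X'(2) by simp
qed

lemma
  shows drazin_inv_power_eq:
      "mat_pow B (mat_index B) = mat_pow B (Suc (mat_index B)) ** drazin_inv B"
    and drazin_inv_outer: "drazin_inv B = drazin_inv B ** B ** drazin_inv B"
    and drazin_inv_commute: "B ** drazin_inv B = drazin_inv B ** B"
proof -
  let ?P = "\<lambda>X. mat_pow B (mat_index B) = mat_pow B (Suc (mat_index B)) ** X \<and>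
       X = X ** B ** X \<and> B ** X = X ** B"
  have "\<exists>!X. ?P X"
    using drazin_inv_exists drazin_inv_unique[of B "mat_index B"] by blast
  then have "?P (drazin_inv B)"
    unfolding drazin_inv_def by (rule theI')
  then show
    "mat_pow B (mat_index B) = mat_pow B (Suc (mat_index B)) ** drazin_inv B"
    "drazin_inv B = drazin_inv B ** B ** drazin_inv B"
    "B ** drazin_inv B = drazin_inv B ** B"
    by blast+
qed

lemma drazin_inv_fixes_pow:
  assumes "mat_index B \<le> k"
  shows "B ** drazin_inv B ** mat_pow B k = mat_pow B k"
proof -
  let ?j = "mat_index B" and ?D = "drazin_inv B"
  obtain i where k: "k = ?j + i"
    using assms le_Suc_ex by blast
  have "B ** (B ** ?D) = (B ** ?D) ** B"
    using drazin_inv_commute by (metis matrix_mul_assoc)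
  then have "mat_pow B ?j ** (B ** ?D) = (B ** ?D) ** mat_pow B ?j"
    by (rule mat_pow_commute)
  moreover have "mat_pow B ?j ** (B ** ?D) = mat_pow B ?j"
    using drazin_inv_power_eq by (metis mat_pow_Suc_right matrix_mul_assoc)
  ultimately show ?thesis
    unfolding k mat_pow_add by (simp add: matrix_mul_assoc)
qed

text \<open>
  If the idempotent \<open>B ** drazin_inv B\<close> fixes \<open>M\<close>, then arbitrarily high powers of \<open>B\<close> can be split
  off \<open>M\<close> on the left, because the idempotent is \<open>B\<^sup>k\<^sup>+\<^sup>1 (drazin_inv B)\<^sup>k\<^sup>+\<^sup>1\<close> for every \<open>k\<close>.
\<close>

lemma mat_range_subset_pow_iff:
  assumes "mat_index B \<le> k"
  shows "mat_range M \<subseteq> mat_range (mat_pow B k) \<longleftrightarrow> B ** drazin_inv B ** M = M"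
proof
  assume "mat_range M \<subseteq> mat_range (mat_pow B k)"
  then obtain Z where "M = mat_pow B k ** Z"
    unfolding mat_range_subset_iff_factor by blast
  then show "B ** drazin_inv B ** M = M"
    using drazin_inv_fixes_pow[OF assms] by (metis matrix_mul_assoc)
next
  let ?D = "drazin_inv B"
  assume "B ** ?D ** M = M"
  then have "M = mat_pow B (Suc k) ** mat_pow ?D (Suc k) ** M"
    using mat_pow_mult_outer_inverse[OF drazin_inv_outer drazin_inv_commute, of B k] by simp
  then have "M = mat_pow B k ** (B ** mat_pow ?D (Suc k) ** M)"
    by (metis mat_pow_Suc_right matrix_mul_assoc)
  then show "mat_range M \<subseteq> mat_range (mat_pow B k)"
    unfolding mat_range_subset_iff_factor by blast
qed

section \<open>Orthogonal projectors\<close>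

lemma Re_hermitian_inner: "Re (hermitian_inner x y) = x \<bullet> y"
  by (simp add: hermitian_inner_def inner_vec_def inner_complex_def)

lemma hermitian_inner_diff_left:
  "hermitian_inner (x - y) z = hermitian_inner x z - hermitian_inner y z"
  by (simp add: hermitian_inner_def sum_subtractf algebra_simps)

lemma hermitian_inner_add_left:
  "hermitian_inner (x + y) z = hermitian_inner x z + hermitian_inner y z"
  by (simp add: hermitian_inner_def sum.distrib algebra_simps)

lemma hermitian_inner_scale_left: "hermitian_inner (c *s x) z = c * hermitian_inner x z"
  by (simp add: hermitian_inner_def sum_distrib_left mult.assoc)

lemma hermitian_inner_scale_right: "hermitian_inner x (c *s z) = cnj c * hermitian_inner x z"
  by (simp add: hermitian_inner_def sum_distrib_left algebra_simps)

lemma hermitian_inner_self_eq_0: "hermitian_inner x x = 0 \<Longrightarrow> x = 0"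
  using Re_hermitian_inner[of x x] by simp

text \<open>
  Real orthogonality to a complex subspace is already complex orthogonality: the imaginary part of
  the Hermitian product with \<open>t\<close> is the real part of the product with \<open>\<i> *s t\<close>.
\<close>

lemma orthogonal_decomposition_exists:
  fixes T :: "(complex^'n) set"
  assumes "vec.subspace T"
  shows "\<exists>y\<in>T. \<forall>t\<in>T. hermitian_inner (x - y) t = 0"
proof -
  have scale: "c *s t \<in> T" if "t \<in> T" for c t
    using assms that by (rule vec.subspace_scale)
  have "r *\<^sub>R t = complex_of_real r *s t" for r and t :: "complex^'n"
    unfolding vec_eq_iff by (simp, simp add: scaleR_conv_of_real)
  then have "subspace T"
    using assms scale unfolding subspace_def vec.subspace_def by auto
  then have span: "span T = T"
    by simp
  obtain y z where y: "y \<in> span T" and z: "\<And>w. w \<in> span T \<Longrightarrow> orthogonal z w" and x: "x = y + z"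
    using orthogonal_subspace_decomp_exists by blast
  have "hermitian_inner z t = 0" if "t \<in> T" for t
  proof (rule complex_eqI)
    show "Re (hermitian_inner z t) = Re 0"
      using z[of t] that by (simp add: Re_hermitian_inner orthogonal_def span)
    have "Re (hermitian_inner z (\<i> *s t)) = 0"
      using z[of "\<i> *s t"] scale[OF that] by (simp add: Re_hermitian_inner orthogonal_def span)
    then show "Im (hermitian_inner z t) = Im 0"
      by (simp add: hermitian_inner_scale_right)
  qed
  then have "\<forall>t\<in>T. hermitian_inner (x - y) t = 0"
    using x by simp
  then show ?thesis
    using y span by auto
qed

lemma orthogonal_decomposition_unique:
  assumes T: "vec.subspace T" and "y \<in> T" "y' \<in> T"
    and "\<forall>t\<in>T. hermitian_inner (x - y) t = 0" "\<forall>t\<in>T. hermitian_inner (x - y') t = 0"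
  shows "y = y'"
proof -
  have "y - y' \<in> T"
    using assms vec.subspace_diff by blast
  then have "hermitian_inner (y - y') (y - y') = 0"
    using assms(4,5) by (simp add: hermitian_inner_diff_left)
  then show ?thesis
    using hermitian_inner_self_eq_0 by fastforce
qed

text \<open>
  Because the decomposition is unique, the map sending a vector to its component in \<open>T\<close> is complex
  linear, and its matrix is the only one with the defining property.
\<close>

lemma orth_projector_spec:
  fixes T :: "(complex^'n) set"
  assumes T: "vec.subspace T"
  shows "orth_projector T *v x \<in> T \<and> (\<forall>t\<in>T. hermitian_inner (x - orth_projector T *v x) t = 0)"
proof -
  define p where "p x = (SOME y. y \<in> T \<and> (\<forall>t\<in>T. hermitian_inner (x - y) t = 0))" for x
  have p: "p x \<in> T \<and> (\<forall>t\<in>T. hermitian_inner (x - p x) t = 0)" for x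
    unfolding p_def by (rule someI_ex) (use orthogonal_decomposition_exists[OF T, of x] in blast)
  have p_eq: "p x = y" if "y \<in> T" "\<And>t. t \<in> T \<Longrightarrow> hermitian_inner (x - y) t = 0" for x y
    using orthogonal_decomposition_unique[OF T] p that by blast
  have "Vector_Spaces.linear (*s) (*s) p"
  proof unfold_locales
    show "p (x + y) = p x + p y" for x y
    proof (rule p_eq)
      show "p x + p y \<in> T"
        using p T vec.subspace_add by blast
      have "hermitian_inner (x + y - (p x + p y)) t
          = hermitian_inner (x - p x) t + hermitian_inner (y - p y) t" for t
        by (simp add: hermitian_inner_diff_left hermitian_inner_add_left)
      then show "hermitian_inner (x + y - (p x + p y)) t = 0" if "t \<in> T" for t
        using p that by simp
    qed
    show "p (c *s x) = c *s p x" for c x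
    proof (rule p_eq)
      show "c *s p x \<in> T"
        using p T vec.subspace_scale by blast
      have "hermitian_inner (c *s x - c *s p x) t = c * hermitian_inner (x - p x) t" for t
        by (simp add: hermitian_inner_diff_left hermitian_inner_scale_left algebra_simps)
      then show "hermitian_inner (c *s x - c *s p x) t = 0" if "t \<in> T" for t
        using p that by simp
    qed
  qed
  then have "matrix p *v x = p x" for x
    by (rule matrix_works)
  then have "\<forall>x. matrix p *v x \<in> T \<and> (\<forall>t\<in>T. hermitian_inner (x - matrix p *v x) t = 0)"
    using p by simp
  moreover have "P = matrix p"
    if "\<forall>x. P *v x \<in> T \<and> (\<forall>t\<in>T. hermitian_inner (x - P *v x) t = 0)" for P
    using that p_eq \<open>\<And>x. matrix p *v x = p x\<close> by (metis matrix_eq)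
  ultimately have
    "\<exists>!P. \<forall>x. P *v x \<in> T \<and> (\<forall>t\<in>T. hermitian_inner (x - P *v x) t = 0)"
    by blast
  from theI'[OF this] show ?thesis
    unfolding orth_projector_def by blast
qed

lemma mat_range_orth_projector: "vec.subspace T \<Longrightarrow> mat_range (orth_projector T) \<subseteq> T"
  unfolding mat_range_def using orth_projector_spec by blast

lemma orth_projector_mult_eq:
  assumes T: "vec.subspace T" and "mat_range M \<subseteq> T"
  shows "orth_projector T ** M = M"
proof -
  have "orth_projector T *v (M *v x) = M *v x" for x
  proof (rule orthogonal_decomposition_unique[OF T, where x = "M *v x"])
    show "M *v x \<in> T"
      using assms(2) unfolding mat_range_def by blast
  qed (use orth_projector_spec[OF T, of "M *v x"] in \<open>auto simp: hermitian_inner_def\<close>)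
  then show ?thesis
    by (simp add: matrix_eq matrix_vector_mul_assoc[symmetric])
qed

section \<open>The core-EP inverse and the weak group inverse\<close>

text \<open>
  The projector onto the core part of \<open>B\<close>, that is, the subspace on which \<open>B\<close> acts invertibly. The
  weighted core-EP inverse uses powers beyond the index, which leave this subspace unchanged.
\<close>

lemma
  fixes B :: "complex^'n^'n"
  assumes k: "mat_index B \<le> k"
  defines "P \<equiv> orth_projector (mat_range (mat_pow B k))"
  shows core_projector_range: "B ** drazin_inv B ** P = P"
    and core_projector_fixes: "B ** drazin_inv B ** M = M \<Longrightarrow> P ** M = M"
  unfolding P_def
  using mat_range_subset_pow_iff[OF k] mat_range_orth_projector[OF subspace_mat_range]
    orth_projector_mult_eq[OF subspace_mat_range]
  by blast+

lemma mat_range_pow_ge_index: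
  assumes "mat_index B \<le> k"
  shows "mat_range (mat_pow B k) = mat_range (mat_pow B (mat_index B))"
  using mat_range_subset_pow_iff[OF assms] mat_range_subset_pow_iff[of B "mat_index B"]
  by (metis order_refl subset_antisym)

text \<open>
  With \<open>P\<close> the orthogonal projector onto the core part of \<open>B\<close>, multiplying \<open>B ** X = P\<close> by
  \<open>drazin_inv B\<close> on the left forces \<open>X = drazin_inv B ** P\<close>, since
  \<open>drazin_inv B ** B\<close> fixes every matrix whose range lies in the core part.
\<close>

lemma core_EP_inv_eq_drazin:
  "core_EP_inv B = drazin_inv B ** orth_projector (mat_range (mat_pow B (mat_index B)))"
proof -
  let ?P = "orth_projector (mat_range (mat_pow B (mat_index B)))" and ?D = "drazin_inv B"
  note range_iff = mat_range_subset_pow_iff[OF order_refl, where B = B]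
  note proj = core_projector_range[OF order_refl, of B]
  have range: "B ** ?D ** (?D ** ?P) = ?D ** ?P"
    using drazin_inv_outer[of B] drazin_inv_commute[of B] by (metis matrix_mul_assoc)
  have product: "B ** (?D ** ?P) = ?P"
    using proj by (simp add: matrix_mul_assoc)
  have solution: "X = ?D ** ?P" if "B ** X = ?P" "B ** ?D ** X = X" for X
    using that drazin_inv_commute[of B] by (metis matrix_mul_assoc)
  show ?thesis
    unfolding core_EP_inv_def range_iff
    by (rule the_equality, rule conjI[OF product range], elim conjE, rule solution)
qed

lemma core_EP_inv_range: "B ** drazin_inv B ** core_EP_inv B = core_EP_inv B"
  unfolding core_EP_inv_eq_drazin
  using drazin_inv_outer[of B] drazin_inv_commute[of B] by (metis matrix_mul_assoc)

lemma mult_core_EP_inv: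
  assumes "mat_index B \<le> k"
  shows "B ** core_EP_inv B = orth_projector (mat_range (mat_pow B k))"
  unfolding core_EP_inv_eq_drazin mat_range_pow_ge_index[OF assms]
  using core_projector_range[OF order_refl, of B] by (simp add: matrix_mul_assoc)

lemma mult_core_EP_inv_square: "B ** core_EP_inv B ** core_EP_inv B = core_EP_inv B"
  unfolding mult_core_EP_inv[OF order_refl]
  by (rule core_projector_fixes[OF order_refl core_EP_inv_range])

text \<open>On the core part of \<open>B\<close>, both the core-EP and the weak group inverse act as inverses of \<open>B\<close>.\<close>

lemma core_EP_inv_cancel:
  assumes "B ** drazin_inv B ** V = V"
  shows "core_EP_inv B ** (B ** V) = V"
proof -
  let ?D = "drazin_inv B"
  have "B ** ?D ** (B ** V) = B ** V"
    using assms drazin_inv_commute[of B] by (metis matrix_mul_assoc)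
  then have "core_EP_inv B ** (B ** V) = ?D ** (B ** V)"
    unfolding core_EP_inv_eq_drazin
    using core_projector_fixes[OF order_refl, of B "B ** V"] by (metis matrix_mul_assoc)
  also have "\<dots> = V"
    using assms drazin_inv_commute[of B] by (metis matrix_mul_assoc)
  finally show ?thesis .
qed

lemma core_EP_inv_pow_cancel:
  assumes "B ** drazin_inv B ** V = V"
  shows "mat_pow (core_EP_inv B) k ** (mat_pow B k ** V) = V"
proof (induction k)
  case (Suc k)
  let ?C = "core_EP_inv B" and ?U = "mat_pow B k ** V"
  have "B ** (B ** drazin_inv B) = (B ** drazin_inv B) ** B"
    using drazin_inv_commute by (metis matrix_mul_assoc)
  then have "B ** drazin_inv B ** ?U = ?U"
    using mat_pow_commute[of B "B ** drazin_inv B" k] assms by (metis matrix_mul_assoc)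
  then have "?C ** (B ** ?U) = ?U"
    by (rule core_EP_inv_cancel)
  moreover have "mat_pow ?C (Suc k) ** (mat_pow B (Suc k) ** V) = mat_pow ?C k ** (?C ** (B ** ?U))"
    by (simp only: mat_pow_Suc_right[of ?C]) (simp add: matrix_mul_assoc)
  ultimately show ?case
    using Suc.IH by simp
qed simp

lemma weak_group_inv_cancel:
  assumes "B ** drazin_inv B ** V = V"
  shows "weak_group_inv m B ** (B ** V) = V"
proof -
  have "weak_group_inv m B ** (B ** V)
      = mat_pow (core_EP_inv B) (Suc m) ** (mat_pow B (Suc m) ** V)"
    unfolding weak_group_inv_def mat_pow_Suc_right[of B] by (simp add: matrix_mul_assoc)
  then show ?thesis
    by (simp only: core_EP_inv_pow_cancel[OF assms])
qed

lemma weak_group_inv_core: "B ** core_EP_inv B ** weak_group_inv m B = weak_group_inv m B"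
  using mult_core_EP_inv_square[of B] unfolding weak_group_inv_def
  by (simp add: matrix_mul_assoc)

section \<open>The weighted inverses\<close>

text \<open>
  The rectangular matrix \<open>A\<close> intertwines \<open>W ** A\<close> and \<open>A ** W\<close>, hence carries the core part of the
  former into that of the latter.
\<close>

lemma core_transfer:
  assumes "W ** A ** drazin_inv (W ** A) ** M = M"
  shows "A ** W ** drazin_inv (A ** W) ** (A ** M) = A ** M"
proof -
  define k where "k = max (mat_index (A ** W)) (mat_index (W ** A))"
  have "mat_range M \<subseteq> mat_range (mat_pow (W ** A) k)"
    by (rule mat_range_subset_pow_iff[THEN iffD2, OF _ assms]) (simp add: k_def)
  then obtain Z where "M = mat_pow (W ** A) k ** Z"
    unfolding mat_range_subset_iff_factor by blast
  then have "A ** M = mat_pow (A ** W) k ** (A ** Z)"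
    by (metis mat_pow_intertwine matrix_mul_assoc)
  then have "mat_range (A ** M) \<subseteq> mat_range (mat_pow (A ** W) k)"
    unfolding mat_range_subset_iff_factor by blast
  then show ?thesis
    by (rule mat_range_subset_pow_iff[THEN iffD1, rotated]) (simp add: k_def)
qed

text \<open>
  Uniqueness: two solutions \<open>X\<close> agree after multiplication by \<open>A ** W ** A ** W\<close>, which the square
  of the Drazin inverse of \<open>A ** W\<close> undoes on the core part of \<open>A ** W\<close>.
\<close>

lemma weighted_core_EP_inv_eq:
  "weighted_core_EP_inv W A = A ** core_EP_inv (W ** A) ** core_EP_inv (W ** A)"
proof -
  define k where "k = max (mat_index (A ** W)) (mat_index (W ** A))"
  define C where "C = core_EP_inv (W ** A)"
  define D where "D = drazin_inv (A ** W)"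
  define P where "P = orth_projector (mat_range (mat_pow (W ** A) k))"
  have k: "mat_index (A ** W) \<le> k" "mat_index (W ** A) \<le> k"
    by (simp_all add: k_def)
  have CC: "W ** A ** C ** C = C" and QC: "W ** A ** C = P"
    unfolding C_def P_def by (rule mult_core_EP_inv_square mult_core_EP_inv[OF k(2)])+
  have "W ** A ** drazin_inv (W ** A) ** (C ** C) = C ** C"
    using core_EP_inv_range[of "W ** A"] unfolding C_def by (simp add: matrix_mul_assoc)
  from core_transfer[OF this] have range: "A ** W ** D ** (A ** C ** C) = A ** C ** C"
    unfolding D_def by (simp add: matrix_mul_assoc)
  have proj: "W ** A ** W ** (A ** C ** C) = P"
    using CC QC by (metis matrix_mul_assoc)
  have comm: "D ** (A ** W) = A ** W ** D"
    unfolding D_def using drazin_inv_commute by metis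
  have solution: "X = D ** (D ** (A ** P))"
    if "W ** A ** W ** X = P" "A ** W ** D ** X = X" for X
  proof -
    have "D ** (D ** (A ** P)) = D ** (D ** (A ** W) ** (A ** W ** X))"
      unfolding that(1)[symmetric] by (simp add: matrix_mul_assoc)
    also have "\<dots> = D ** (A ** W ** (D ** (A ** W) ** X))"
      using comm by (metis matrix_mul_assoc)
    also have "\<dots> = X"
      using comm that(2) by (metis matrix_mul_assoc)
    finally show ?thesis by simp
  qed
  have unique: "X = A ** C ** C" if "W ** A ** W ** X = P" "A ** W ** D ** X = X" for X
    using solution[OF that] solution[OF proj range] by simp
  have "(THE X. W ** A ** W ** X = P \<and> A ** W ** D ** X = X) = A ** C ** C"
    by (rule the_equality, rule conjI[OF proj range], elim conjE, rule unique)
  then show ?thesis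
    unfolding weighted_core_EP_inv_def Let_def k_def[symmetric] mat_range_subset_pow_iff[OF k(1)]
    by (simp only: P_def C_def D_def)
qed

lemma W_pow_Suc_Suc: "W_pow W X (Suc (Suc l)) = X ** W ** W_pow W X (Suc l)"
  by (simp add: W_pow_def W_prod_def)

lemma mult_W_pow: "W ** W_pow W A (Suc l) = mat_pow (W ** A) (Suc l)"
proof (induction l)
  case 0
  show ?case by (simp add: W_pow_def)
next
  case (Suc l)
  have "W ** W_pow W A (Suc (Suc l)) = W ** A ** (W ** W_pow W A (Suc l))"
    by (simp add: W_pow_Suc_Suc matrix_mul_assoc)
  then show ?case
    by (simp only: Suc.IH mat_pow.simps)
qed

lemma W_pow_weighted_core_EP_inv:
  "W_pow W (weighted_core_EP_inv W A) (Suc l)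
    = A ** mat_pow (core_EP_inv (W ** A)) (Suc (Suc l))"
proof (induction l)
  case 0
  show ?case by (simp add: W_pow_def weighted_core_EP_inv_eq matrix_mul_assoc)
next
  case (Suc l)
  let ?C = "core_EP_inv (W ** A)"
  have "W_pow W (weighted_core_EP_inv W A) (Suc (Suc l))
      = A ** ?C ** ?C ** W ** (A ** mat_pow ?C (Suc (Suc l)))"
    using Suc.IH by (simp only: W_pow_Suc_Suc) (simp only: weighted_core_EP_inv_eq)
  also have "\<dots> = A ** ?C ** ?C ** (W ** A ** ?C ** ?C) ** mat_pow ?C l"
    by (simp add: matrix_mul_assoc)
  also have "\<dots> = A ** mat_pow ?C (Suc (Suc (Suc l)))"
    by (simp only: mult_core_EP_inv_square) (simp add: matrix_mul_assoc)
  finally show ?case .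
qed

lemma weighted_weak_group_inv_eq:
  assumes "m > 0"
  shows "weighted_weak_group_inv m W A
    = A ** (core_EP_inv (W ** A) ** weak_group_inv m (W ** A))"
proof -
  obtain l where m: "m = Suc l"
    using assms gr0_conv_Suc by blast
  have "weighted_weak_group_inv m W A
      = W_pow W (weighted_core_EP_inv W A) (Suc m) ** (W ** W_pow W A m)"
    by (simp add: weighted_weak_group_inv_def matrix_mul_assoc)
  also have "\<dots> = A ** mat_pow (core_EP_inv (W ** A)) (Suc (Suc m)) ** mat_pow (W ** A) m"
    unfolding m by (simp only: W_pow_weighted_core_EP_inv mult_W_pow)
  also have "\<dots> = A ** (core_EP_inv (W ** A) ** weak_group_inv m (W ** A))"
    by (simp add: weak_group_inv_def matrix_mul_assoc)
  finally show ?thesis .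
qed

theorem theorem3p7:
  fixes A :: "complex^'n^'q" and W :: "complex^'q^'n" and m :: nat
  assumes "W \<noteq> 0" and "m > 0"
  shows "weighted_weak_group_inv m W A
           = weak_group_inv m (A ** W) ** A ** weak_group_inv m (W ** A) \<and>
         weighted_weak_group_inv m W A
           = core_EP_inv (A ** W) ** A ** weak_group_inv m (W ** A) \<and>
         weighted_weak_group_inv m W A
           = drazin_inv (A ** W) ** A ** weak_group_inv m (W ** A)"
proof -
  define G where "G = weak_group_inv m (W ** A)"
  define V where "V = A ** (core_EP_inv (W ** A) ** G)"
  have V: "weighted_weak_group_inv m W A = V"
    unfolding V_def G_def by (rule weighted_weak_group_inv_eq[OF assms(2)])
  have AG: "A ** G = A ** W ** V"
    using weak_group_inv_core[of "W ** A" m] unfolding V_def G_def by (metis matrix_mul_assoc)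
  have "W ** A ** drazin_inv (W ** A) ** (core_EP_inv (W ** A) ** G) = core_EP_inv (W ** A) ** G"
    using core_EP_inv_range[of "W ** A"] by (simp add: matrix_mul_assoc)
  then have core: "A ** W ** drazin_inv (A ** W) ** V = V"
    unfolding V_def by (rule core_transfer)
  have "weak_group_inv m (A ** W) ** (A ** G) = V"
    unfolding AG by (rule weak_group_inv_cancel[OF core])
  moreover have "core_EP_inv (A ** W) ** (A ** G) = V"
    unfolding AG by (rule core_EP_inv_cancel[OF core])
  moreover have "drazin_inv (A ** W) ** (A ** G) = V"
    unfolding AG using core drazin_inv_commute[of "A ** W"] by (metis matrix_mul_assoc)
  ultimately show ?thesis
    unfolding V G_def by (simp add: matrix_mul_assoc)
qed

end
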